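(* There is an isomorphism of groups $$\mathrm{GL}_2(\mathbb{Z}) \;\simeq\; D_4 *_{D_2} D_6 .$$
   Context: $\mathrm{GL}_2(\mathbb{Z})$ is the group of $2\times 2$ integer matrices with determinant $\pm 1$. $D_n=\langle r,s \mid r^n=s^2=(sr)^2=1\rangle$ is the dihedral group of order $2n$; thus $D_2$ is the Klein four-group. $D_4 *_{D_2} D_6$ is the free product of $D_4$ and $D_6$ amalgamated along $D_2$ (the pushout in the category of groups) via the embeddings $D_2\to D_4$, $r\mapsto r^2$, $s\mapsto s$, and $D_2\to D_6$, $r\mapsto r^3$, $s\mapsto s$. These are the embeddings $\mathbb{Z}_2\rtimes\mathbb{Z}_2\to\mathbb{Z}_4\rtimes\mathbb{Z}_2$ and $\mathbb{Z}_2\rtimes\mathbb{Z}_2\to\mathbb{Z}_6\rtimes\mathbb{Z}_2$ induced by the inclusions $\mathbb{Z}_2\le\mathbb{Z}_4$ and $\mathbb{Z}_2\le\mathbb{Z}_6$. *)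

theory Defs
  imports "HOL-Analysis.Determinants" "HOL-Algebra.Coset"
begin

section \<open>The general linear group over the integers\<close>

definition GL2Z :: "(int ^ 2 ^ 2) monoid" where
  "GL2Z = \<lparr>carrier = {A. det A = 1 \<or> det A = -1}, mult = (**), one = mat 1\<rparr>"

lemma group_GL2Z: "group GL2Z"
proof (rule groupI)
  fix A assume "A \<in> carrier GL2Z"
  then have d: "det A = 1 \<or> det A = -1" by (simp add: GL2Z_def)
  define B :: "int ^ 2 ^ 2" where "B = (\<chi> i j. det A *
    (if i = 1 then (if j = 1 then A$2$2 else - A$1$2) else (if j = 1 then - A$2$1 else A$1$1)))"
  have dA: "det A = A$1$1 * A$2$2 - A$1$2 * A$2$1" by (simp add: det_2)
  have sq: "det A * det A = 1" using d by auto
  have one: "B ** A = mat 1"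
  proof -
    have "(B ** A) $ i $ j = (mat 1 :: int ^ 2 ^ 2) $ i $ j" for i j
    proof -
      have "(B ** A) $ 1 $ 1 = det A * det A" "(B ** A) $ 2 $ 2 = det A * det A"
        "(B ** A) $ 1 $ 2 = 0" "(B ** A) $ 2 $ 1 = 0"
        by (simp_all add: B_def matrix_matrix_mult_def sum_2 dA algebra_simps)
      then show ?thesis using exhaust_2[of i] exhaust_2[of j] sq by (auto simp: mat_def)
    qed
    then show ?thesis by (simp add: vec_eq_iff)
  qed
  have "det B * det A = 1" using arg_cong[OF one, of det] by (simp add: det_mul)
  then have "det B = 1 \<or> det B = -1" using d by auto
  then show "\<exists>C\<in>carrier GL2Z. C \<otimes>\<^bsub>GL2Z\<^esub> A = \<one>\<^bsub>GL2Z\<^esub>"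
    using one by (auto simp: GL2Z_def)
qed (auto simp: GL2Z_def det_mul matrix_mul_assoc)


section \<open>Quotients of word monoids\<close>

text \<open>The congruence on the free monoid of words that is generated by a set of relations \<open>R\<close>.\<close>

inductive word_cong :: "('x list \<times> 'x list) set \<Rightarrow> 'x list \<Rightarrow> 'x list \<Rightarrow> bool"
  for R where
  rel: "(l, r) \<in> R \<Longrightarrow> word_cong R (u @ l @ v) (u @ r @ v)"
| refl: "word_cong R w w"
| sym: "word_cong R w w' \<Longrightarrow> word_cong R w' w"
| trans: "word_cong R w w' \<Longrightarrow> word_cong R w' w'' \<Longrightarrow> word_cong R w w''"

definition word_class :: "('x list \<times> 'x list) set \<Rightarrow> 'x list \<Rightarrow> 'x list set" where
  "word_class R w = {w'. word_cong R w w'}"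

definition word_quotient ::
    "'x set \<Rightarrow> ('x list \<times> 'x list) set \<Rightarrow> 'x list set monoid" where
  "word_quotient X R =
    \<lparr>carrier = word_class R ` lists X,
     mult = (\<lambda>U V. \<Union>u\<in>U. \<Union>v\<in>V. word_class R (u @ v)),
     one = word_class R []\<rparr>"

text \<open>The value of a word in \<open>G\<close>, its letters being interpreted by \<open>\<phi>\<close>, and the map that it
  induces on classes of words; the latter is meaningful if \<open>\<phi>\<close> respects the relations.\<close>

definition word_eval :: "('a, 'b) monoid_scheme \<Rightarrow> ('x \<Rightarrow> 'a) \<Rightarrow> 'x list \<Rightarrow> 'a" where
  "word_eval G \<phi> w = foldr (\<lambda>x y. \<phi> x \<otimes>\<^bsub>G\<^esub> y) w \<one>\<^bsub>G\<^esub>"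

definition word_lift :: "('a, 'b) monoid_scheme \<Rightarrow> ('x \<Rightarrow> 'a) \<Rightarrow> 'x list set \<Rightarrow> 'a" where
  "word_lift G \<phi> W = the_elem (word_eval G \<phi> ` W)"

lemma word_cong_append_left: "word_cong R v v' \<Longrightarrow> word_cong R (u @ v) (u @ v')"
proof (induction rule: word_cong.induct)
  case (rel l r p q)
  then show ?case using word_cong.rel[of l r R "u @ p" q] by simp
qed (auto intro: word_cong.intros)

lemma word_cong_append_right: "word_cong R u u' \<Longrightarrow> word_cong R (u @ v) (u' @ v)"
proof (induction rule: word_cong.induct)
  case (rel l r p q)
  then show ?case using word_cong.rel[of l r R p "q @ v"] by simp
qed (auto intro: word_cong.intros)

lemma word_cong_append:
  "word_cong R u u' \<Longrightarrow> word_cong R v v' \<Longrightarrow> word_cong R (u @ v) (u' @ v')"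
  by (blast intro: word_cong.trans word_cong_append_left word_cong_append_right)

lemma word_cong_rel: "(l, r) \<in> R \<Longrightarrow> word_cong R l r"
  using word_cong.rel[of l r R "[]" "[]"] by simp

lemma word_class_eq_iff: "word_class R u = word_class R v \<longleftrightarrow> word_cong R u v"
  unfolding word_class_def by (blast intro: word_cong.intros)

lemma word_class_self: "w \<in> word_class R w"
  by (simp add: word_class_def word_cong.refl)

lemma word_quotient_mult:
  "word_class R u \<otimes>\<^bsub>word_quotient X R\<^esub> word_class R v = word_class R (u @ v)"
proof -
  have "word_class R (u' @ v') = word_class R (u @ v)"
    if "u' \<in> word_class R u" "v' \<in> word_class R v" for u' v'
    using that unfolding word_class_eq_iff
    by (auto simp: word_class_def intro: word_cong.sym word_cong_append)
  then have "(\<Union>u'\<in>word_class R u. \<Union>v'\<in>word_class R v. word_class R (u' @ v')) =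
      (\<Union>u'\<in>word_class R u. \<Union>v'\<in>word_class R v. word_class R (u @ v))"
    by (intro SUP_cong HOL.refl)
  also have "\<dots> = word_class R (u @ v)"
    using word_class_self[of u R] word_class_self[of v R] by blast
  finally show ?thesis by (simp add: word_quotient_def)
qed

lemma word_quotient_one: "\<one>\<^bsub>word_quotient X R\<^esub> = word_class R []"
  by (simp add: word_quotient_def)

lemma word_quotient_carrier: "carrier (word_quotient X R) = word_class R ` lists X"
  by (simp add: word_quotient_def)

lemma word_quotient_m_closed:
  assumes "U \<in> carrier (word_quotient X R)" "V \<in> carrier (word_quotient X R)"
  shows "U \<otimes>\<^bsub>word_quotient X R\<^esub> V \<in> carrier (word_quotient X R)"
proof -
  obtain u v where "u \<in> lists X" "U = word_class R u" "v \<in> lists X" "V = word_class R v"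
    using assms by (auto simp: word_quotient_carrier)
  then have "u @ v \<in> lists X" "U \<otimes>\<^bsub>word_quotient X R\<^esub> V = word_class R (u @ v)"
    by (simp_all add: word_quotient_mult)
  then show ?thesis by (metis imageI word_quotient_carrier)
qed

lemma monoid_word_quotient: "monoid (word_quotient X R)"
  by (rule monoidI)
    (auto intro: word_quotient_m_closed,
      auto simp: word_quotient_carrier word_quotient_one word_quotient_mult)

lemma group_word_quotient:
  assumes "\<And>x. x \<in> X \<Longrightarrow> \<exists>y\<in>X. word_cong R [y, x] []"
  shows "group (word_quotient X R)"
proof (rule groupI)
  fix W assume "W \<in> carrier (word_quotient X R)"
  then obtain w where w: "w \<in> lists X" "W = word_class R w"
    by (auto simp: word_quotient_carrier)
  from w(1) have "\<exists>w'\<in>lists X. word_cong R (w' @ w) []"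
  proof (induction w)
    case Nil
    show ?case by (auto intro: word_cong.refl bexI[of _ "[]"])
  next
    case (Cons x w)
    obtain y where y: "y \<in> X" "word_cong R [y, x] []" using assms Cons.hyps by blast
    obtain w' where w': "w' \<in> lists X" "word_cong R (w' @ w) []" using Cons.IH by blast
    have "word_cong R (w' @ ([y, x] @ w)) (w' @ ([] @ w))"
      by (intro word_cong_append_left word_cong_append_right y(2))
    then have "word_cong R ((w' @ [y]) @ x # w) []"
      using w'(2) by (auto intro: word_cong.trans)
    then show ?case using w'(1) y(1) by (intro bexI[of _ "w' @ [y]"]) auto
  qed
  then show "\<exists>V\<in>carrier (word_quotient X R).
      V \<otimes>\<^bsub>word_quotient X R\<^esub> W = \<one>\<^bsub>word_quotient X R\<^esub>"
    by (auto simp: w word_quotient_carrier word_quotient_one word_quotient_mult word_class_eq_iff)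
qed (auto intro: word_quotient_m_closed,
    auto simp: word_quotient_carrier word_quotient_one word_quotient_mult)

lemma word_eval_simps [simp]:
  "word_eval G \<phi> [] = \<one>\<^bsub>G\<^esub>"
  "word_eval G \<phi> (x # w) = \<phi> x \<otimes>\<^bsub>G\<^esub> word_eval G \<phi> w"
  by (simp_all add: word_eval_def)

context
  fixes G :: "('a, 'b) monoid_scheme" and \<phi> :: "'x \<Rightarrow> 'a"
    and X :: "'x set" and R :: "('x list \<times> 'x list) set"
  assumes mon: "monoid G"
    and X: "\<And>x. x \<in> X \<Longrightarrow> \<phi> x \<in> carrier G"
    and R: "R \<subseteq> lists X \<times> lists X"
    and resp: "\<And>l r. (l, r) \<in> R \<Longrightarrow> word_eval G \<phi> l = word_eval G \<phi> r"
begin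

interpretation monoid G by (rule mon)

lemma word_eval_closed: "w \<in> lists X \<Longrightarrow> word_eval G \<phi> w \<in> carrier G"
  by (induction w) (auto simp: X)

lemma word_eval_append:
  "u \<in> lists X \<Longrightarrow> v \<in> lists X \<Longrightarrow>
    word_eval G \<phi> (u @ v) = word_eval G \<phi> u \<otimes>\<^bsub>G\<^esub> word_eval G \<phi> v"
  by (induction u) (auto simp: X m_assoc word_eval_closed)

lemma word_eval_cong:
  assumes "word_cong R u v"
  shows "(u \<in> lists X \<longleftrightarrow> v \<in> lists X) \<and>
    (u \<in> lists X \<longrightarrow> word_eval G \<phi> u = word_eval G \<phi> v)"
  using assms
proof (induction rule: word_cong.induct)
  case (rel l r u v)
  then have "l \<in> lists X" "r \<in> lists X" using R by auto
  then show ?case using resp[OF rel] by (auto simp: word_eval_append)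
qed auto

lemma word_lift_class:
  assumes "w \<in> lists X"
  shows "word_lift G \<phi> (word_class R w) = word_eval G \<phi> w"
proof -
  have "word_eval G \<phi> ` word_class R w = {word_eval G \<phi> w}"
  proof (rule equalityI)
    show "word_eval G \<phi> ` word_class R w \<subseteq> {word_eval G \<phi> w}"
    proof (rule image_subsetI)
      fix w' assume "w' \<in> word_class R w"
      then have "word_eval G \<phi> w = word_eval G \<phi> w'"
        using word_eval_cong[of w w'] assms by (simp only: word_class_def mem_Collect_eq)
      then show "word_eval G \<phi> w' \<in> {word_eval G \<phi> w}" by simp
    qed
  qed (use word_class_self in blast)
  then show ?thesis by (simp add: word_lift_def)
qed

lemma word_lift_hom: "word_lift G \<phi> \<in> hom (word_quotient X R) G"
proof (rule homI)
  fix U V assume "U \<in> carrier (word_quotient X R)" "V \<in> carrier (word_quotient X R)"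
  then obtain u v where uv: "u \<in> lists X" "v \<in> lists X" "U = word_class R u" "V = word_class R v"
    by (auto simp: word_quotient_carrier)
  then have "u @ v \<in> lists X" by simp
  with uv show "word_lift G \<phi> (U \<otimes>\<^bsub>word_quotient X R\<^esub> V) =
      word_lift G \<phi> U \<otimes>\<^bsub>G\<^esub> word_lift G \<phi> V"
    by (simp only: word_quotient_mult word_lift_class word_eval_append)
next
  fix W assume "W \<in> carrier (word_quotient X R)"
  then obtain w where "w \<in> lists X" "W = word_class R w"
    by (auto simp: word_quotient_carrier)
  then show "word_lift G \<phi> W \<in> carrier G"
    by (simp only: word_lift_class word_eval_closed)
qed

end

lemma hom_word_quotient_unique:
  assumes "group (word_quotient X R)" "group G"
    and h: "h \<in> hom (word_quotient X R) G" and k: "k \<in> hom (word_quotient X R) G"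
    and eq: "\<And>x. x \<in> X \<Longrightarrow> h (word_class R [x]) = k (word_class R [x])"
    and W: "W \<in> carrier (word_quotient X R)"
  shows "h W = k W"
proof -
  obtain w where w: "w \<in> lists X" "W = word_class R w"
    using W by (auto simp: word_quotient_carrier)
  from w(1) have "h (word_class R w) = k (word_class R w)"
  proof (induction w)
    case Nil
    show ?case using hom_one[OF h] hom_one[OF k] assms(1,2) by (simp add: word_quotient_one)
  next
    case (Cons x w)
    have *: "word_class R (x # w) = word_class R [x] \<otimes>\<^bsub>word_quotient X R\<^esub> word_class R w"
      by (simp add: word_quotient_mult)
    show ?case unfolding *
      using Cons hom_mult[OF h] hom_mult[OF k] eq by (auto simp: word_quotient_carrier)
  qed
  then show ?thesis by (simp add: w)
qed


section \<open>Groups given by generators and relators\<close>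

text \<open>The letter \<open>(x, True)\<close> stands for the generator \<open>x\<close>, and \<open>(x, False)\<close> for its formal
  inverse.\<close>

definition pres_rels :: "('x \<times> bool) list set \<Rightarrow> (('x \<times> bool) list \<times> ('x \<times> bool) list) set" where
  "pres_rels S = {([(x, b), (x, \<not> b)], []) | x b. True} \<union> {(w, []) | w. w \<in> S}"

definition presented_group :: "('x \<times> bool) list set \<Rightarrow> ('x \<times> bool) list set monoid" where
  "presented_group S = word_quotient UNIV (pres_rels S)"

definition letter_val :: "('a, 'b) monoid_scheme \<Rightarrow> ('x \<Rightarrow> 'a) \<Rightarrow> 'x \<times> bool \<Rightarrow> 'a" where
  "letter_val G f = (\<lambda>(x, b). if b then f x else inv\<^bsub>G\<^esub> f x)"

lemma group_presented_group: "group (presented_group S)"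
  unfolding presented_group_def
proof (rule group_word_quotient)
  fix x :: "'a \<times> bool"
  obtain y b where "x = (y, b)" by (cases x)
  then have "word_cong (pres_rels S) [(y, \<not> b), x] []"
    by (intro word_cong_rel) (auto simp: pres_rels_def)
  then show "\<exists>y\<in>UNIV. word_cong (pres_rels S) [y, x] []" by blast
qed

lemma
  assumes G: "group G" and f: "\<And>x. f x \<in> carrier G"
    and rel: "\<And>w. w \<in> S \<Longrightarrow> word_eval G (letter_val G f) w = \<one>\<^bsub>G\<^esub>"
  shows presented_group_lift_hom: "word_lift G (letter_val G f) \<in> hom (presented_group S) G"
    and presented_group_lift_class:
      "word_lift G (letter_val G f) (word_class (pres_rels S) w) = word_eval G (letter_val G f) w"
proof -
  interpret group G by (rule G)
  have val: "letter_val G f x \<in> carrier G" for x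
    using f by (auto simp: letter_val_def split: prod.split)
  have resp: "word_eval G (letter_val G f) l = word_eval G (letter_val G f) r"
    if "(l, r) \<in> pres_rels S" for l r
    using that rel f by (auto simp: pres_rels_def letter_val_def)
  show "word_lift G (letter_val G f) \<in> hom (presented_group S) G"
    unfolding presented_group_def
    by (rule word_lift_hom) (auto simp: val resp monoid_axioms)
  show "word_lift G (letter_val G f) (word_class (pres_rels S) w) = word_eval G (letter_val G f) w"
    by (rule word_lift_class[where X = UNIV]) (auto simp: val resp monoid_axioms)
qed


section \<open>Dihedral groups\<close>

datatype dgen = Rot | Flip

definition dihedral_relators :: "nat \<Rightarrow> (dgen \<times> bool) list set" where
  "dihedral_relators n =
    {replicate n (Rot, True),
     [(Flip, True), (Flip, True)],
     [(Flip, True), (Rot, True), (Flip, True), (Rot, True)]}"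

definition dihedral :: "nat \<Rightarrow> (dgen \<times> bool) list set monoid" where
  "dihedral n = presented_group (dihedral_relators n)"

definition dihedral_gen :: "nat \<Rightarrow> dgen \<Rightarrow> (dgen \<times> bool) list set" where
  "dihedral_gen n x = word_class (pres_rels (dihedral_relators n)) [(x, True)]"

text \<open>The homomorphism to \<open>dihedral n\<close> with \<open>r \<mapsto> r\<^sup>k\<close>, \<open>s \<mapsto> s\<close>. Its domain is \<open>dihedral m\<close> for
  any \<open>m\<close> such that \<open>n\<close> divides \<open>m * k\<close>.\<close>

definition dihedral_map ::
    "nat \<Rightarrow> nat \<Rightarrow> (dgen \<times> bool) list set \<Rightarrow> (dgen \<times> bool) list set" where
  "dihedral_map n k =
    word_lift (dihedral n)
      (letter_val (dihedral n)
        (\<lambda>x. case x of Rot \<Rightarrow> dihedral_gen n Rot [^]\<^bsub>dihedral n\<^esub> k | Flip \<Rightarrow> dihedral_gen n Flip))"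

lemma group_dihedral: "group (dihedral n)"
  by (simp add: dihedral_def group_presented_group)

lemma dihedral_gen_closed: "dihedral_gen n x \<in> carrier (dihedral n)"
  by (auto simp: dihedral_gen_def dihedral_def presented_group_def word_quotient_carrier)

lemma word_eval_replicate:
  assumes "group G" "f x \<in> carrier G"
  shows "word_eval G (letter_val G f) (replicate n (x, True)) = f x [^]\<^bsub>G\<^esub> n"
proof -
  interpret group G by fact
  show ?thesis
  proof (induction n)
    case (Suc n)
    then show ?case using nat_pow_Suc2[OF assms(2), of n] by (simp add: letter_val_def)
  qed simp
qed

context
  fixes G :: "('a, 'b) monoid_scheme" and \<rho> \<sigma> :: 'a and n :: nat
  assumes G: "group G" and closed: "\<rho> \<in> carrier G" "\<sigma> \<in> carrier G"
    and rels: "\<rho> [^]\<^bsub>G\<^esub> n = \<one>\<^bsub>G\<^esub>" "\<sigma> \<otimes>\<^bsub>G\<^esub> \<sigma> = \<one>\<^bsub>G\<^esub>"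
      "(\<sigma> \<otimes>\<^bsub>G\<^esub> \<rho>) \<otimes>\<^bsub>G\<^esub> (\<sigma> \<otimes>\<^bsub>G\<^esub> \<rho>) = \<one>\<^bsub>G\<^esub>"
begin

interpretation group G by (rule G)

lemma
  shows dihedral_lift_hom:
      "word_lift G (letter_val G (case_dgen \<rho> \<sigma>)) \<in> hom (dihedral n) G"
    and dihedral_lift_class:
      "word_lift G (letter_val G (case_dgen \<rho> \<sigma>)) (word_class (pres_rels (dihedral_relators n)) w)
        = word_eval G (letter_val G (case_dgen \<rho> \<sigma>)) w"
proof -
  have f: "case_dgen \<rho> \<sigma> x \<in> carrier G" for x using closed by (cases x) auto
  have r: "word_eval G (letter_val G (case_dgen \<rho> \<sigma>)) w = \<one>\<^bsub>G\<^esub>" if "w \<in> dihedral_relators n" for w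
    using that closed rels word_eval_replicate[of G "case_dgen \<rho> \<sigma>" Rot n, OF G]
    by (auto simp: dihedral_relators_def letter_val_def m_assoc)
  show "word_lift G (letter_val G (case_dgen \<rho> \<sigma>)) \<in> hom (dihedral n) G"
    unfolding dihedral_def by (rule presented_group_lift_hom) (use G f r in auto)
  show "word_lift G (letter_val G (case_dgen \<rho> \<sigma>)) (word_class (pres_rels (dihedral_relators n)) w)
        = word_eval G (letter_val G (case_dgen \<rho> \<sigma>)) w"
    by (rule presented_group_lift_class) (use G f r in auto)
qed

lemma dihedral_lift_gen:
  "word_lift G (letter_val G (case_dgen \<rho> \<sigma>)) (dihedral_gen n Rot) = \<rho>"
  "word_lift G (letter_val G (case_dgen \<rho> \<sigma>)) (dihedral_gen n Flip) = \<sigma>"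
  unfolding dihedral_gen_def dihedral_lift_class using closed by (auto simp: letter_val_def)

end

lemma dihedral_relator_eval:
  assumes "w \<in> dihedral_relators n"
  shows "word_class (pres_rels (dihedral_relators n)) w = \<one>\<^bsub>dihedral n\<^esub>"
  using assms
  by (auto simp: dihedral_def presented_group_def word_quotient_one word_class_eq_iff
      pres_rels_def intro!: word_cong_rel)

lemma dihedral_gen_pow:
  "dihedral_gen n x [^]\<^bsub>dihedral n\<^esub> (k::nat) =
    word_class (pres_rels (dihedral_relators n)) (replicate k (x, True))"
proof (induction k)
  case 0
  then show ?case by (simp add: dihedral_def presented_group_def word_quotient_one)
next
  case (Suc k)
  then show ?case
    by (simp add: dihedral_def presented_group_def word_quotient_mult dihedral_gen_def
        replicate_append_same)
qed

lemma dihedral_relations: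
  "dihedral_gen n Rot [^]\<^bsub>dihedral n\<^esub> n = \<one>\<^bsub>dihedral n\<^esub>"
  "dihedral_gen n Flip \<otimes>\<^bsub>dihedral n\<^esub> dihedral_gen n Flip = \<one>\<^bsub>dihedral n\<^esub>"
  "(dihedral_gen n Flip \<otimes>\<^bsub>dihedral n\<^esub> dihedral_gen n Rot) \<otimes>\<^bsub>dihedral n\<^esub>
    (dihedral_gen n Flip \<otimes>\<^bsub>dihedral n\<^esub> dihedral_gen n Rot) = \<one>\<^bsub>dihedral n\<^esub>"
proof -
  show "dihedral_gen n Rot [^]\<^bsub>dihedral n\<^esub> n = \<one>\<^bsub>dihedral n\<^esub>"
    unfolding dihedral_gen_pow
    by (rule dihedral_relator_eval) (simp add: dihedral_relators_def)
  show "dihedral_gen n Flip \<otimes>\<^bsub>dihedral n\<^esub> dihedral_gen n Flip = \<one>\<^bsub>dihedral n\<^esub>"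
    using dihedral_relator_eval[of "[(Flip, True), (Flip, True)]" n]
    by (simp add: dihedral_def presented_group_def word_quotient_mult dihedral_gen_def
        dihedral_relators_def)
  show "(dihedral_gen n Flip \<otimes>\<^bsub>dihedral n\<^esub> dihedral_gen n Rot) \<otimes>\<^bsub>dihedral n\<^esub>
    (dihedral_gen n Flip \<otimes>\<^bsub>dihedral n\<^esub> dihedral_gen n Rot) = \<one>\<^bsub>dihedral n\<^esub>"
    using dihedral_relator_eval[of "[(Flip, True), (Rot, True), (Flip, True), (Rot, True)]" n]
    by (simp add: dihedral_def presented_group_def word_quotient_mult dihedral_gen_def
        dihedral_relators_def)
qed

lemma (in group) dihedral_conj_pow:
  assumes c: "\<rho> \<in> carrier G" "\<sigma> \<in> carrier G"
    and s: "\<sigma> \<otimes> \<sigma> = \<one>" and sr: "(\<sigma> \<otimes> \<rho>) \<otimes> (\<sigma> \<otimes> \<rho>) = \<one>"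
  shows "(\<sigma> \<otimes> \<rho> [^] (k::nat)) \<otimes> (\<sigma> \<otimes> \<rho> [^] k) = \<one>"
proof -
  have rsr: "\<rho> \<otimes> (\<sigma> \<otimes> \<rho>) = \<sigma>"
  proof -
    have "\<sigma> \<otimes> (\<rho> \<otimes> (\<sigma> \<otimes> \<rho>)) = \<sigma> \<otimes> \<sigma>" using c s sr by (simp add: m_assoc)
    then show ?thesis using c by simp
  qed
  have "\<rho> [^] k \<otimes> (\<sigma> \<otimes> \<rho> [^] k) = \<sigma>"
  proof (induction k)
    case 0
    show ?case using c by simp
  next
    case (Suc k)
    have "\<rho> [^] Suc k \<otimes> (\<sigma> \<otimes> \<rho> [^] Suc k) = (\<rho> [^] k \<otimes> \<rho>) \<otimes> (\<sigma> \<otimes> (\<rho> \<otimes> \<rho> [^] k))"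
      using nat_pow_Suc2[OF c(1), of k] by simp
    also have "\<dots> = \<rho> [^] k \<otimes> ((\<rho> \<otimes> (\<sigma> \<otimes> \<rho>)) \<otimes> \<rho> [^] k)" using c by (simp add: m_assoc)
    also have "\<dots> = \<sigma>" using Suc rsr by simp
    finally show ?case .
  qed
  then show ?thesis using c s by (simp add: m_assoc)
qed

lemma
  assumes "n dvd m * k"
  shows dihedral_map_hom: "dihedral_map n k \<in> hom (dihedral m) (dihedral n)"
    and dihedral_map_Rot:
      "dihedral_map n k (dihedral_gen m Rot) = dihedral_gen n Rot [^]\<^bsub>dihedral n\<^esub> k"
    and dihedral_map_Flip: "dihedral_map n k (dihedral_gen m Flip) = dihedral_gen n Flip"
proof -
  interpret D: group "dihedral n" by (rule group_dihedral)
  let ?r = "dihedral_gen n Rot" and ?s = "dihedral_gen n Flip"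
  note c = dihedral_gen_closed[of n]
  obtain j where j: "m * k = n * j" using assms by (auto simp: dvd_def)
  have 1: "(?r [^]\<^bsub>dihedral n\<^esub> k) [^]\<^bsub>dihedral n\<^esub> m = \<one>\<^bsub>dihedral n\<^esub>"
    using c D.nat_pow_pow[OF c, of Rot n j] dihedral_relations(1)[of n] j
    by (simp add: D.nat_pow_pow mult.commute)
  note 2 = D.dihedral_conj_pow[OF c c dihedral_relations(2,3), of k]
  note prems = group_dihedral D.nat_pow_closed[OF c] c 1 dihedral_relations(2) 2
  show "dihedral_map n k \<in> hom (dihedral m) (dihedral n)"
    unfolding dihedral_map_def by (rule dihedral_lift_hom[OF prems])
  show "dihedral_map n k (dihedral_gen m Rot) = ?r [^]\<^bsub>dihedral n\<^esub> k"
    unfolding dihedral_map_def by (rule dihedral_lift_gen(1)[OF prems])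
  show "dihedral_map n k (dihedral_gen m Flip) = ?s"
    unfolding dihedral_map_def by (rule dihedral_lift_gen(2)[OF prems])
qed


lemma (in monoid) nat_pow_2_3:
  assumes "x \<in> carrier G"
  shows "x [^] (2::nat) = x \<otimes> x" "x [^] (3::nat) = x \<otimes> x \<otimes> x"
  using assms by (simp_all add: numeral_2_eq_2 numeral_3_eq_3)

lemma dihedral_2_elements:
  assumes "W \<in> carrier (dihedral 2)"
  shows "W \<in> {\<one>\<^bsub>dihedral 2\<^esub>, dihedral_gen 2 Rot, dihedral_gen 2 Flip,
    dihedral_gen 2 Flip \<otimes>\<^bsub>dihedral 2\<^esub> dihedral_gen 2 Rot}"
proof -
  let ?R = "pres_rels (dihedral_relators 2)"
  interpret D: group "dihedral 2" by (rule group_dihedral)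
  define r s where "r = dihedral_gen 2 Rot" and "s = dihedral_gen 2 Flip"
  have c: "r \<in> carrier (dihedral 2)" "s \<in> carrier (dihedral 2)"
    by (simp_all add: r_def s_def dihedral_gen_closed)
  have rr: "r \<otimes>\<^bsub>dihedral 2\<^esub> r = \<one>\<^bsub>dihedral 2\<^esub>"
    using dihedral_relations(1)[of 2] D.nat_pow_2_3(1)[OF c(1)] by (simp add: r_def)
  have ss: "s \<otimes>\<^bsub>dihedral 2\<^esub> s = \<one>\<^bsub>dihedral 2\<^esub>"
    using dihedral_relations(2)[of 2] by (simp add: s_def)
  have "(s \<otimes>\<^bsub>dihedral 2\<^esub> r) \<otimes>\<^bsub>dihedral 2\<^esub> (s \<otimes>\<^bsub>dihedral 2\<^esub> r) = \<one>\<^bsub>dihedral 2\<^esub>"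
    using dihedral_relations(3)[of 2] by (simp add: s_def r_def)
  then have "inv\<^bsub>dihedral 2\<^esub> (s \<otimes>\<^bsub>dihedral 2\<^esub> r) = s \<otimes>\<^bsub>dihedral 2\<^esub> r"
    using c by (intro D.inv_equality) auto
  then have rs: "r \<otimes>\<^bsub>dihedral 2\<^esub> s = s \<otimes>\<^bsub>dihedral 2\<^esub> r"
    using c D.inv_equality[OF rr] D.inv_equality[OF ss] by (simp add: D.inv_mult_group)
  have rsr: "r \<otimes>\<^bsub>dihedral 2\<^esub> (s \<otimes>\<^bsub>dihedral 2\<^esub> r) = s"
    using c rr rs by (simp flip: D.m_assoc) (simp add: D.m_assoc)
  have ssr: "s \<otimes>\<^bsub>dihedral 2\<^esub> (s \<otimes>\<^bsub>dihedral 2\<^esub> r) = r"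
    using c ss by (simp flip: D.m_assoc)
  have letter: "word_class ?R [x] \<in> {r, s}" for x
  proof -
    obtain y b where x: "x = (y, b)" by (cases x)
    have *: "word_class ?R [(y, True)] = dihedral_gen 2 y" for y
      by (simp add: dihedral_gen_def)
    have "word_class ?R [(y, False)] \<otimes>\<^bsub>dihedral 2\<^esub> dihedral_gen 2 y = \<one>\<^bsub>dihedral 2\<^esub>" for y
      by (auto simp: dihedral_gen_def dihedral_def presented_group_def word_quotient_mult
          word_quotient_one word_class_eq_iff pres_rels_def intro!: word_cong_rel)
    moreover have "word_class ?R [(y, False)] \<in> carrier (dihedral 2)" for y
      by (simp add: dihedral_def presented_group_def word_quotient_carrier)
    ultimately have "word_class ?R [(y, False)] = inv\<^bsub>dihedral 2\<^esub> dihedral_gen 2 y" for y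
      using D.inv_equality dihedral_gen_closed by metis
    then show ?thesis
      using * c D.inv_equality[OF rr] D.inv_equality[OF ss]
      by (cases y; cases b) (simp_all add: x r_def s_def)
  qed
  obtain w where w: "W = word_class ?R w"
    using assms by (auto simp: dihedral_def presented_group_def word_quotient_carrier)
  have "word_class ?R w \<in> {\<one>\<^bsub>dihedral 2\<^esub>, r, s, s \<otimes>\<^bsub>dihedral 2\<^esub> r}"
  proof (induction w)
    case Nil
    show ?case by (simp add: dihedral_def presented_group_def word_quotient_one)
  next
    case (Cons x w)
    have "word_class ?R (x # w) = word_class ?R [x] \<otimes>\<^bsub>dihedral 2\<^esub> word_class ?R w"
      by (simp add: dihedral_def presented_group_def word_quotient_mult)
    then show ?case using letter[of x] Cons c rr ss rs rsr ssr by auto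
  qed
  then show ?thesis by (simp add: w r_def s_def)
qed

lemma dihedral_2_hom_inj:
  assumes "group G" "group K" and h: "h \<in> hom (dihedral 2) G" and k: "k \<in> hom G K"
    and "k (h (dihedral_gen 2 Rot)) = \<rho>" "k (h (dihedral_gen 2 Flip)) = \<sigma>"
    and "\<rho> \<noteq> \<one>\<^bsub>K\<^esub>" "\<sigma> \<noteq> \<one>\<^bsub>K\<^esub>" "\<sigma> \<otimes>\<^bsub>K\<^esub> \<rho> \<noteq> \<one>\<^bsub>K\<^esub>"
  shows "inj_on h (carrier (dihedral 2))"
proof -
  interpret group_hom "dihedral 2" G h
    by (intro group_hom.intro group_hom_axioms.intro group_dihedral assms)
  show ?thesis
  proof (subst inj_on_one_iff, intro allI impI)
    fix W assume W: "W \<in> carrier (dihedral 2)" "h W = \<one>\<^bsub>G\<^esub>"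
    then have "k (h W) = \<one>\<^bsub>K\<^esub>" using Group.hom_one[OF k assms(1,2)] by simp
    then show "W = \<one>\<^bsub>dihedral 2\<^esub>"
      using dihedral_2_elements[OF W(1)] assms dihedral_gen_closed[of 2]
      by (auto simp: Group.hom_mult[OF h] Group.hom_mult[OF k] hom_in_carrier[OF h])
  qed
qed

text \<open>Injectivity of the two maps is seen in faithful actions on \<open>\<int>\<^sup>2\<close>.\<close>

definition mat22 :: "int \<Rightarrow> int \<Rightarrow> int \<Rightarrow> int \<Rightarrow> int ^ 2 ^ 2" where
  "mat22 a b c d = (\<chi> i j. if i = 1 then (if j = 1 then a else b) else (if j = 1 then c else d))"

lemma mat22_simps:
  "mat22 a b c d ** mat22 a' b' c' d' =
    mat22 (a * a' + b * c') (a * b' + b * d') (c * a' + d * c') (c * b' + d * d')"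
  "mat 1 = mat22 1 0 0 1"
  "mat22 a b c d = mat22 a' b' c' d' \<longleftrightarrow> a = a' \<and> b = b' \<and> c = c' \<and> d = d'"
  "det (mat22 a b c d) = a * d - b * c"
  by (auto simp: mat22_def vec_eq_iff forall_2 matrix_matrix_mult_def sum_2 mat_def det_2)

lemma dihedral_map_4_2_inj: "inj_on (dihedral_map 4 2) (carrier (dihedral 2))"
proof -
  interpret group GL2Z by (rule group_GL2Z)
  let ?r = "mat22 0 (-1) 1 0" and ?s = "mat22 0 1 1 0"
  have prems: "?r \<in> carrier GL2Z" "?s \<in> carrier GL2Z" "?r [^]\<^bsub>GL2Z\<^esub> (4::nat) = \<one>\<^bsub>GL2Z\<^esub>"
      "?s \<otimes>\<^bsub>GL2Z\<^esub> ?s = \<one>\<^bsub>GL2Z\<^esub>"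
      "(?s \<otimes>\<^bsub>GL2Z\<^esub> ?r) \<otimes>\<^bsub>GL2Z\<^esub> (?s \<otimes>\<^bsub>GL2Z\<^esub> ?r) = \<one>\<^bsub>GL2Z\<^esub>"
    by (simp_all add: GL2Z_def mat22_simps numeral_eq_Suc nat_pow_def)
  let ?k = "word_lift GL2Z (letter_val GL2Z (case_dgen ?r ?s))"
  have k: "?k \<in> hom (dihedral 4) GL2Z" by (rule dihedral_lift_hom[OF group_GL2Z prems])
  note kg = dihedral_lift_gen[OF group_GL2Z prems]
  have sq: "?k (dihedral_gen 4 Rot [^]\<^bsub>dihedral 4\<^esub> (2::nat)) = mat22 (-1) 0 0 (-1)"
    using dihedral_gen_closed[of 4 Rot]
    by (simp add: group_dihedral group.is_monoid monoid.nat_pow_2_3 hom_mult[OF k] kg)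
      (simp add: GL2Z_def mat22_simps)
  have d: "(4::nat) dvd 2 * 2" by simp
  show ?thesis
    by (rule dihedral_2_hom_inj[OF group_dihedral group_GL2Z dihedral_map_hom[OF d] k])
      (auto simp: dihedral_map_Rot[OF d] dihedral_map_Flip[OF d] sq kg,
        auto simp: GL2Z_def mat22_simps)
qed

lemma dihedral_map_6_3_inj: "inj_on (dihedral_map 6 3) (carrier (dihedral 2))"
proof -
  interpret group GL2Z by (rule group_GL2Z)
  let ?r = "mat22 1 (-1) 1 0" and ?s = "mat22 0 1 1 0"
  have prems: "?r \<in> carrier GL2Z" "?s \<in> carrier GL2Z" "?r [^]\<^bsub>GL2Z\<^esub> (6::nat) = \<one>\<^bsub>GL2Z\<^esub>"
      "?s \<otimes>\<^bsub>GL2Z\<^esub> ?s = \<one>\<^bsub>GL2Z\<^esub>"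
      "(?s \<otimes>\<^bsub>GL2Z\<^esub> ?r) \<otimes>\<^bsub>GL2Z\<^esub> (?s \<otimes>\<^bsub>GL2Z\<^esub> ?r) = \<one>\<^bsub>GL2Z\<^esub>"
    by (simp_all add: GL2Z_def mat22_simps numeral_eq_Suc nat_pow_def)
  let ?k = "word_lift GL2Z (letter_val GL2Z (case_dgen ?r ?s))"
  have k: "?k \<in> hom (dihedral 6) GL2Z" by (rule dihedral_lift_hom[OF group_GL2Z prems])
  note kg = dihedral_lift_gen[OF group_GL2Z prems]
  have cube: "?k (dihedral_gen 6 Rot [^]\<^bsub>dihedral 6\<^esub> (3::nat)) = mat22 (-1) 0 0 (-1)"
    using dihedral_gen_closed[of 6 Rot]
    by (simp add: group_dihedral group.is_monoid monoid.nat_pow_2_3 monoid.m_closed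
        hom_mult[OF k] kg)
      (simp add: GL2Z_def mat22_simps)
  have d: "(6::nat) dvd 2 * 3" by simp
  show ?thesis
    by (rule dihedral_2_hom_inj[OF group_dihedral group_GL2Z dihedral_map_hom[OF d] k])
      (auto simp: dihedral_map_Rot[OF d] dihedral_map_Flip[OF d] cube kg,
        auto simp: GL2Z_def mat22_simps)
qed


section \<open>Amalgamated free products\<close>

definition amalgam_rels ::
    "('h, 'i) monoid_scheme \<Rightarrow> ('a, 'c) monoid_scheme \<Rightarrow> ('b, 'd) monoid_scheme \<Rightarrow>
      ('h \<Rightarrow> 'a) \<Rightarrow> ('h \<Rightarrow> 'b) \<Rightarrow> (('a + 'b) list \<times> ('a + 'b) list) set" where
  "amalgam_rels H A B f g =
    {([Inl \<one>\<^bsub>A\<^esub>], []), ([Inr \<one>\<^bsub>B\<^esub>], [])} \<union>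
    {([Inl x, Inl y], [Inl (x \<otimes>\<^bsub>A\<^esub> y)]) | x y. x \<in> carrier A \<and> y \<in> carrier A} \<union>
    {([Inr x, Inr y], [Inr (x \<otimes>\<^bsub>B\<^esub> y)]) | x y. x \<in> carrier B \<and> y \<in> carrier B} \<union>
    {([Inl (f h)], [Inr (g h)]) | h. h \<in> carrier H}"

text \<open>The pushout of \<open>f : H \<rightarrow> A\<close> and \<open>g : H \<rightarrow> B\<close>, as a quotient of the words in the
  elements of \<open>A\<close> and \<open>B\<close>; see \<open>amalgam_universal\<close> below.\<close>

definition amalgam ::
    "('h, 'i) monoid_scheme \<Rightarrow> ('a, 'c) monoid_scheme \<Rightarrow> ('b, 'd) monoid_scheme \<Rightarrow>
      ('h \<Rightarrow> 'a) \<Rightarrow> ('h \<Rightarrow> 'b) \<Rightarrow> ('a + 'b) list set monoid" where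
  "amalgam H A B f g = word_quotient (carrier A <+> carrier B) (amalgam_rels H A B f g)"

definition amalgam_inl where
  "amalgam_inl H A B f g x = word_class (amalgam_rels H A B f g) [Inl x]"

definition amalgam_inr where
  "amalgam_inr H A B f g y = word_class (amalgam_rels H A B f g) [Inr y]"

lemma group_amalgam:
  assumes "group A" "group B"
  shows "group (amalgam H A B f g)"
  unfolding amalgam_def
proof (rule group_word_quotient)
  let ?R = "amalgam_rels H A B f g"
  interpret A: group A by fact
  interpret B: group B by fact
  fix x assume "x \<in> carrier A <+> carrier B"
  then consider a where "x = Inl a" "a \<in> carrier A" | b where "x = Inr b" "b \<in> carrier B"
    by blast
  then show "\<exists>y\<in>carrier A <+> carrier B. word_cong ?R [y, x] []"
  proof cases
    case 1
    have "word_cong ?R [Inl (inv\<^bsub>A\<^esub> a), Inl a] [Inl (inv\<^bsub>A\<^esub> a \<otimes>\<^bsub>A\<^esub> a)]"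
      by (rule word_cong_rel) (use 1 in \<open>simp add: amalgam_rels_def\<close>)
    moreover have "word_cong ?R [Inl \<one>\<^bsub>A\<^esub>] []"
      by (rule word_cong_rel) (simp add: amalgam_rels_def)
    ultimately have "word_cong ?R [Inl (inv\<^bsub>A\<^esub> a), x] []"
      using 1 by (auto intro: word_cong.trans)
    then show ?thesis using 1 by (intro bexI[of _ "Inl (inv\<^bsub>A\<^esub> a)"]) auto
  next
    case 2
    have "word_cong ?R [Inr (inv\<^bsub>B\<^esub> b), Inr b] [Inr (inv\<^bsub>B\<^esub> b \<otimes>\<^bsub>B\<^esub> b)]"
      by (rule word_cong_rel) (use 2 in \<open>simp add: amalgam_rels_def\<close>)
    moreover have "word_cong ?R [Inr \<one>\<^bsub>B\<^esub>] []"
      by (rule word_cong_rel) (simp add: amalgam_rels_def)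
    ultimately have "word_cong ?R [Inr (inv\<^bsub>B\<^esub> b), x] []"
      using 2 by (auto intro: word_cong.trans)
    then show ?thesis using 2 by (intro bexI[of _ "Inr (inv\<^bsub>B\<^esub> b)"]) auto
  qed
qed

lemma amalgam_inl_hom: "amalgam_inl H A B f g \<in> hom A (amalgam H A B f g)"
proof (rule homI)
  fix x assume "x \<in> carrier A"
  then have "[Inl x] \<in> lists (carrier A <+> carrier B)" by auto
  then show "amalgam_inl H A B f g x \<in> carrier (amalgam H A B f g)"
    unfolding amalgam_inl_def amalgam_def word_quotient_carrier by (rule imageI)
next
  fix x y assume "x \<in> carrier A" "y \<in> carrier A"
  then have "word_cong (amalgam_rels H A B f g) [Inl x, Inl y] [Inl (x \<otimes>\<^bsub>A\<^esub> y)]"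
    by (intro word_cong_rel) (simp add: amalgam_rels_def)
  then show "amalgam_inl H A B f g (x \<otimes>\<^bsub>A\<^esub> y) =
      amalgam_inl H A B f g x \<otimes>\<^bsub>amalgam H A B f g\<^esub> amalgam_inl H A B f g y"
    by (simp add: amalgam_inl_def amalgam_def word_quotient_mult word_class_eq_iff word_cong.sym)
qed

lemma amalgam_inr_hom: "amalgam_inr H A B f g \<in> hom B (amalgam H A B f g)"
proof (rule homI)
  fix x assume "x \<in> carrier B"
  then have "[Inr x] \<in> lists (carrier A <+> carrier B)" by auto
  then show "amalgam_inr H A B f g x \<in> carrier (amalgam H A B f g)"
    unfolding amalgam_inr_def amalgam_def word_quotient_carrier by (rule imageI)
next
  fix x y assume "x \<in> carrier B" "y \<in> carrier B"
  then have "word_cong (amalgam_rels H A B f g) [Inr x, Inr y] [Inr (x \<otimes>\<^bsub>B\<^esub> y)]"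
    by (intro word_cong_rel) (simp add: amalgam_rels_def)
  then show "amalgam_inr H A B f g (x \<otimes>\<^bsub>B\<^esub> y) =
      amalgam_inr H A B f g x \<otimes>\<^bsub>amalgam H A B f g\<^esub> amalgam_inr H A B f g y"
    by (simp add: amalgam_inr_def amalgam_def word_quotient_mult word_class_eq_iff word_cong.sym)
qed

lemma amalgam_commute:
  "h \<in> carrier H \<Longrightarrow> amalgam_inl H A B f g (f h) = amalgam_inr H A B f g (g h)"
  unfolding amalgam_inl_def amalgam_inr_def word_class_eq_iff
  by (rule word_cong_rel) (auto simp: amalgam_rels_def)

theorem amalgam_universal:
  assumes "group A" "group B" "group K"
    and f: "f \<in> hom H A" and g: "g \<in> hom H B"
    and \<alpha>: "\<alpha> \<in> hom A K" and \<beta>: "\<beta> \<in> hom B K"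
    and comm: "\<And>h. h \<in> carrier H \<Longrightarrow> \<alpha> (f h) = \<beta> (g h)"
  shows "\<exists>!\<gamma>. \<gamma> \<in> hom (amalgam H A B f g) K \<and> \<gamma> \<in> extensional (carrier (amalgam H A B f g)) \<and>
    (\<forall>x\<in>carrier A. \<gamma> (amalgam_inl H A B f g x) = \<alpha> x) \<and>
    (\<forall>y\<in>carrier B. \<gamma> (amalgam_inr H A B f g y) = \<beta> y)"
proof -
  let ?P = "amalgam H A B f g" and ?R = "amalgam_rels H A B f g"
  let ?X = "carrier A <+> carrier B"
  let ?\<phi> = "case_sum \<alpha> \<beta>"
  interpret A: group A by fact
  interpret B: group B by fact
  interpret K: group K by fact
  have cl: "?\<phi> x \<in> carrier K" if "x \<in> ?X" for x
    using that \<alpha> \<beta> by (auto simp: hom_in_carrier)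
  have R: "?R \<subseteq> lists ?X \<times> lists ?X"
    using f g by (auto simp: amalgam_rels_def hom_in_carrier)
  have resp: "word_eval K ?\<phi> l = word_eval K ?\<phi> r" if "(l, r) \<in> ?R" for l r
    using that f g \<alpha> \<beta> hom_one[OF \<alpha>] hom_one[OF \<beta>] assms(1-3)
    by (auto simp: amalgam_rels_def hom_in_carrier hom_mult comm)
  note pr = K.monoid_axioms cl R resp
  define \<gamma> where "\<gamma> = restrict (word_lift K ?\<phi>) (carrier ?P)"
  have lift: "word_lift K ?\<phi> \<in> hom ?P K"
    unfolding amalgam_def by (rule word_lift_hom[OF pr])
  have \<gamma>1: "\<gamma> \<in> hom ?P K" "\<gamma> \<in> extensional (carrier ?P)"
    using lift group.subgroup_self[OF group_amalgam[OF assms(1,2), of H f g]]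
      monoid.m_closed[OF monoid_word_quotient[of ?X ?R]]
    by (auto simp: \<gamma>_def hom_def Pi_iff amalgam_def)
  have \<gamma>2: "\<gamma> (amalgam_inl H A B f g x) = \<alpha> x" if x: "x \<in> carrier A" for x
  proof -
    have "word_lift K ?\<phi> (word_class ?R [Inl x]) = word_eval K ?\<phi> [Inl x]"
      by (rule word_lift_class[OF pr]) (use x in auto)
    then show ?thesis
      using hom_in_carrier[OF amalgam_inl_hom x, of H B f g] hom_in_carrier[OF \<alpha> x]
      by (simp add: \<gamma>_def amalgam_inl_def)
  qed
  have \<gamma>3: "\<gamma> (amalgam_inr H A B f g y) = \<beta> y" if y: "y \<in> carrier B" for y
  proof -
    have "word_lift K ?\<phi> (word_class ?R [Inr y]) = word_eval K ?\<phi> [Inr y]"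
      by (rule word_lift_class[OF pr]) (use y in auto)
    then show ?thesis
      using hom_in_carrier[OF amalgam_inr_hom y, of H A f g] hom_in_carrier[OF \<beta> y]
      by (simp add: \<gamma>_def amalgam_inr_def)
  qed
  show ?thesis
  proof (rule ex1I)
    show "\<gamma> \<in> hom ?P K \<and> \<gamma> \<in> extensional (carrier ?P) \<and>
      (\<forall>x\<in>carrier A. \<gamma> (amalgam_inl H A B f g x) = \<alpha> x) \<and>
      (\<forall>y\<in>carrier B. \<gamma> (amalgam_inr H A B f g y) = \<beta> y)"
      using \<gamma>1 \<gamma>2 \<gamma>3 by blast
  next
    fix \<delta>
    assume \<delta>: "\<delta> \<in> hom ?P K \<and> \<delta> \<in> extensional (carrier ?P) \<and>
      (\<forall>x\<in>carrier A. \<delta> (amalgam_inl H A B f g x) = \<alpha> x) \<and>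
      (\<forall>y\<in>carrier B. \<delta> (amalgam_inr H A B f g y) = \<beta> y)"
    have "\<delta> W = \<gamma> W" if W: "W \<in> carrier ?P" for W
    proof (rule hom_word_quotient_unique)
      show "group (word_quotient ?X ?R)" using group_amalgam[OF assms(1,2)] by (simp add: amalgam_def)
      show "\<delta> (word_class ?R [x]) = \<gamma> (word_class ?R [x])" if "x \<in> ?X" for x
        using that \<delta> \<gamma>2 \<gamma>3 by (auto simp: amalgam_inl_def amalgam_inr_def)
    qed (use \<delta> \<gamma>1 W assms(3) in \<open>auto simp: amalgam_def\<close>)
    then show "\<delta> = \<gamma>" using \<delta> \<gamma>1 by (auto intro: extensionalityI)
  qed
qed

end

theory Submission
  imports Defs
begin

text \<open>Let \<open>a\<close>, \<open>b\<close> be the rotations of order 4 and 6 and \<open>s\<close> the common flip. In the amalgam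
  \<open>z = a\<^sup>2 = b\<^sup>3\<close> is a central involution and \<open>s\<close> inverts \<open>a\<close> and \<open>b\<close>, so every element is of the
  form \<open>c m d e\<close> with \<open>c\<close> a power of \<open>a\<close>, \<open>d \<in> {1, b, b\<^sup>2}\<close>, \<open>e \<in> {1, s}\<close> and \<open>m\<close> a product of
  the elements \<open>z b a\<close> and \<open>z b\<^sup>2 a\<close>. These two act on \<open>\<int>\<^sup>2\<close> as the elementary matrices with
  nonnegative entries, so \<open>m\<close> has a nonnegative matrix with positive diagonal, which is not the
  identity unless \<open>m = 1\<close>. The inverses of the matrices of \<open>c\<close>, \<open>d\<close>, \<open>e\<close> combine to a matrix with
  this sign pattern only if \<open>c = d = e = 1\<close>, hence the map to the matrix group is injective. It is
  surjective by the Euclidean algorithm.\<close>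

section \<open>Words in the generators\<close>

text \<open>Products grow only on the right, so that a case analysis strips the last factor, the one
  that meets a letter multiplied from the right.\<close>

inductive_set submonoid_gen :: "('a, 'b) monoid_scheme \<Rightarrow> 'a set \<Rightarrow> 'a set"
  for G (structure) and S where
  one: "\<one> \<in> submonoid_gen G S"
| mult: "m \<in> submonoid_gen G S \<Longrightarrow> x \<in> S \<Longrightarrow> m \<otimes> x \<in> submonoid_gen G S"

lemma (in monoid) submonoid_gen_closed:
  assumes "S \<subseteq> carrier G" "m \<in> submonoid_gen G S"
  shows "m \<in> carrier G"
  using assms(2) by induction (use assms(1) in auto)

lemma dihedral_letter:
  "word_class (pres_rels (dihedral_relators n)) [(y, b)] =
    (if b then dihedral_gen n y else inv\<^bsub>dihedral n\<^esub> dihedral_gen n y)"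
proof -
  interpret D: group "dihedral n" by (rule group_dihedral)
  let ?R = "pres_rels (dihedral_relators n)"
  have "word_class ?R [(y, False)] \<otimes>\<^bsub>dihedral n\<^esub> dihedral_gen n y = \<one>\<^bsub>dihedral n\<^esub>"
    by (auto simp: dihedral_gen_def dihedral_def presented_group_def word_quotient_mult
        word_quotient_one word_class_eq_iff pres_rels_def intro!: word_cong_rel)
  moreover have "word_class ?R [(y, False)] \<in> carrier (dihedral n)"
    by (simp add: dihedral_def presented_group_def word_quotient_carrier)
  ultimately have "inv\<^bsub>dihedral n\<^esub> dihedral_gen n y = word_class ?R [(y, False)]"
    using dihedral_gen_closed by (intro D.inv_equality)
  then show ?thesis by (simp add: dihedral_gen_def)
qed

text \<open>Finite order turns inverses into positive powers, so closure under multiplication by the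
  generators alone will suffice.\<close>

lemma dihedral_gen_inv:
  assumes "n > 0"
  shows "inv\<^bsub>dihedral n\<^esub> dihedral_gen n Rot = dihedral_gen n Rot [^]\<^bsub>dihedral n\<^esub> (n - 1)"
    and "inv\<^bsub>dihedral n\<^esub> dihedral_gen n Flip = dihedral_gen n Flip"
proof -
  interpret D: group "dihedral n" by (rule group_dihedral)
  note c = dihedral_gen_closed[of n]
  have "dihedral_gen n Rot [^]\<^bsub>dihedral n\<^esub> (n - 1) \<otimes>\<^bsub>dihedral n\<^esub> dihedral_gen n Rot =
      dihedral_gen n Rot [^]\<^bsub>dihedral n\<^esub> Suc (n - 1)" by simp
  also have "\<dots> = \<one>\<^bsub>dihedral n\<^esub>" using assms dihedral_relations(1)[of n] by simp
  finally show "inv\<^bsub>dihedral n\<^esub> dihedral_gen n Rot = dihedral_gen n Rot [^]\<^bsub>dihedral n\<^esub> (n - 1)"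
    using c by (intro D.inv_equality) auto
  show "inv\<^bsub>dihedral n\<^esub> dihedral_gen n Flip = dihedral_gen n Flip"
    using c by (intro D.inv_equality dihedral_relations)
qed

text \<open>Reduces stability under a whole dihedral image to the two generators: the letters of a
  word are absorbed into \<open>v\<close> one by one, inverse letters being replaced by positive
  powers.\<close>

lemma dihedral_image_right_closed:
  assumes "group G" "n > 0" and h: "h \<in> hom (dihedral n) G" and N: "N \<subseteq> carrier G"
    and gen: "\<And>v y. v \<in> N \<Longrightarrow> v \<otimes>\<^bsub>G\<^esub> h (dihedral_gen n y) \<in> N"
    and W: "W \<in> carrier (dihedral n)" and v: "v \<in> N"
  shows "v \<otimes>\<^bsub>G\<^esub> h W \<in> N"
proof -
  let ?R = "pres_rels (dihedral_relators n)"
  interpret G: group G by fact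
  interpret D: group "dihedral n" by (rule group_dihedral)
  note c = dihedral_gen_closed[of n]
  have pow: "v \<otimes>\<^bsub>G\<^esub> h (dihedral_gen n y [^]\<^bsub>dihedral n\<^esub> (k::nat)) \<in> N" if "v \<in> N" for v y k
  proof (induction k)
    case 0
    show ?case using that N hom_one[OF h] group_dihedral assms(1) by auto
  next
    case (Suc k)
    have "v \<otimes>\<^bsub>G\<^esub> h (dihedral_gen n y [^]\<^bsub>dihedral n\<^esub> Suc k) =
        v \<otimes>\<^bsub>G\<^esub> h (dihedral_gen n y [^]\<^bsub>dihedral n\<^esub> k) \<otimes>\<^bsub>G\<^esub> h (dihedral_gen n y)"
      using that N c hom_in_carrier[OF h] by (subst G.m_assoc) (auto simp: hom_mult[OF h])
    then show ?case using gen[OF Suc] by simp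
  qed
  have letter: "v \<otimes>\<^bsub>G\<^esub> h (word_class ?R [x]) \<in> N" if "v \<in> N" for v x
    using gen[OF that] pow[OF that] dihedral_gen_inv[OF assms(2)]
    by (cases x; cases "fst x") (auto simp: dihedral_letter)
  obtain w where w: "W = word_class ?R w"
    using W by (auto simp: dihedral_def presented_group_def word_quotient_carrier)
  have cl: "word_class ?R w \<in> carrier (dihedral n)" for w
    by (simp add: dihedral_def presented_group_def word_quotient_carrier)
  have "v \<otimes>\<^bsub>G\<^esub> h (word_class ?R w) \<in> N" using v
  proof (induction w arbitrary: v)
    case Nil
    then show ?case using pow[of v Rot 0]
      by (simp add: dihedral_def presented_group_def word_quotient_one)
  next
    case (Cons x w)
    have "word_class ?R (x # w) = word_class ?R [x] \<otimes>\<^bsub>dihedral n\<^esub> word_class ?R w"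
      by (simp add: dihedral_def presented_group_def word_quotient_mult)
    then have "v \<otimes>\<^bsub>G\<^esub> h (word_class ?R (x # w)) =
        v \<otimes>\<^bsub>G\<^esub> h (word_class ?R [x]) \<otimes>\<^bsub>G\<^esub> h (word_class ?R w)"
      using Cons.prems N cl hom_in_carrier[OF h] by (auto simp: hom_mult[OF h] G.m_assoc)
    then show ?case using Cons.IH[OF letter[OF Cons.prems]] by simp
  qed
  then show ?thesis by (simp add: w)
qed

text \<open>For the normal forms only right multiplication is under control, so the induction on
  words peels off the last letter.\<close>

lemma amalgam_subset_right_closed:
  fixes H A B f g
  defines "P \<equiv> amalgam H A B f g"
  assumes one: "\<one>\<^bsub>P\<^esub> \<in> N"
    and l: "\<And>v x. v \<in> N \<Longrightarrow> x \<in> carrier A \<Longrightarrow> v \<otimes>\<^bsub>P\<^esub> amalgam_inl H A B f g x \<in> N"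
    and r: "\<And>v x. v \<in> N \<Longrightarrow> x \<in> carrier B \<Longrightarrow> v \<otimes>\<^bsub>P\<^esub> amalgam_inr H A B f g x \<in> N"
  shows "carrier P \<subseteq> N"
proof
  let ?R = "amalgam_rels H A B f g"
  fix W assume "W \<in> carrier P"
  then obtain w where w: "w \<in> lists (carrier A <+> carrier B)" "W = word_class ?R w"
    by (auto simp: P_def amalgam_def word_quotient_carrier)
  from w(1) have "word_class ?R w \<in> N"
  proof (induction w rule: rev_induct)
    case Nil
    show ?case using one by (simp add: P_def amalgam_def word_quotient_one)
  next
    case (snoc x w)
    have "word_class ?R (w @ [x]) = word_class ?R w \<otimes>\<^bsub>P\<^esub> word_class ?R [x]"
      by (simp add: P_def amalgam_def word_quotient_mult)
    then show ?case
      using snoc l[of "word_class ?R w"] r[of "word_class ?R w"]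
      by (auto simp: amalgam_inl_def amalgam_inr_def)
  qed
  then show "W \<in> N" by (simp add: w)
qed

section \<open>Generators of the integral matrix group\<close>

lemma mat22_exhaust: obtains p q r t where "A = mat22 p q r t"
proof
  show "A = mat22 (A$1$1) (A$1$2) (A$2$1) (A$2$2)"
    by (simp add: mat22_def vec_eq_iff forall_2)
qed

lemma GL2Z_mat22:
  "mat22 p q r t \<in> carrier GL2Z \<longleftrightarrow> \<bar>p * t - q * r\<bar> = 1"
  "mat22 a b c d \<otimes>\<^bsub>GL2Z\<^esub> mat22 a' b' c' d' =
    mat22 (a * a' + b * c') (a * b' + b * d') (c * a' + d * c') (c * b' + d * d')"
  "\<one>\<^bsub>GL2Z\<^esub> = mat22 1 0 0 1"
  by (auto simp: GL2Z_def mat22_simps)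

text \<open>The Euclidean algorithm on the first column.\<close>

lemma GL2Z_generated:
  assumes a: "mat22 0 (-1) 1 0 \<in> H" and b: "mat22 1 (-1) 1 0 \<in> H" and s: "mat22 0 1 1 0 \<in> H"
    and mult: "\<And>x y. x \<in> H \<Longrightarrow> y \<in> H \<Longrightarrow> x \<otimes>\<^bsub>GL2Z\<^esub> y \<in> H"
  shows "carrier GL2Z \<subseteq> H"
proof
  note calc = GL2Z_mat22
  have neg: "mat22 (-1) 0 0 (-1) \<in> H" using mult[OF a a] by (simp add: calc)
  have refl: "mat22 1 0 0 (-1) \<in> H" using mult[OF s a] by (simp add: calc)
  have up: "mat22 1 1 0 1 \<in> H" using mult[OF neg mult[OF b a]] by (simp add: calc)
  \<comment> \<open>\<open>H\<close> is only assumed closed under products, so the inverse shear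
    needs its own word in the generators.\<close>
  have down: "mat22 1 (-1) 0 1 \<in> H" using mult[OF neg mult[OF a mult[OF b b]]] by (simp add: calc)
  have shear: "mat22 1 k 0 1 \<in> H" for k
  proof (induction k rule: int_induct[where k = 0])
    case base
    show ?case using mult[OF s s] by (simp add: calc)
  next
    case (step1 i)
    then show ?case using mult[OF up step1(2)] by (simp add: calc)
  next
    case (step2 i)
    then show ?case using mult[OF down step2(2)] by (simp add: calc)
  qed
  have main: "mat22 p q r t \<in> H" if "\<bar>p * t - q * r\<bar> = 1" for p q r t
    using that
  proof (induction "nat \<bar>r\<bar>" arbitrary: p q r t rule: less_induct)
    case less
    show ?case
    proof (cases "r = 0")
      case True
      with less.prems have pt: "\<bar>p * t\<bar> = 1" by simp
      then have "\<bar>p\<bar> = 1 \<and> \<bar>t\<bar> = 1" by (auto simp: abs_mult zmult_eq_1_iff)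
      then have "p = 1 \<or> p = -1" "t = 1 \<or> t = -1" by auto
      \<comment> \<open>The diagonal signs come from \<open>neg\<close> and \<open>refl\<close>;
        each of them also flips the sign of the upper right entry, whence \<open>-q\<close> when
        just one occurs.\<close>
      then show ?thesis
        using True shear[of q] mult[OF shear[of "-q"] refl]
          mult[OF neg shear[of "-q"]] mult[OF neg mult[OF shear[of q] refl]]
        by (auto simp: calc)
    next
      case False
      \<comment> \<open>Euclidean step: subtract \<open>k\<close> times the second row from the
        first, then swap the rows. The determinant only changes sign.\<close>
      define k where "k = p div r"
      have pm: "p mod r = p - k * r" by (simp add: k_def minus_div_mult_eq_mod)
      have "nat \<bar>p mod r\<bar> < nat \<bar>r\<bar>" using False abs_mod_less[of r p] by simp
      moreover have "\<bar>r * (q - k * t) - t * (p mod r)\<bar> = 1"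
        using less.prems by (simp add: pm algebra_simps abs_if split: if_splits)
      ultimately have "mat22 r t (p mod r) (q - k * t) \<in> H" by (rule less.hyps)
      from mult[OF shear[of k] mult[OF s this]] show ?thesis by (simp add: calc pm)
    qed
  qed
  fix A assume "A \<in> carrier GL2Z"
  then show "A \<in> H" by (cases A rule: mat22_exhaust) (auto simp: calc intro: main)
qed

section \<open>Normal forms\<close>

text \<open>Separates the computation from the construction of the amalgam: relations and a matrix
  representation are given, while generation enters only through the hypothesis of
  \<open>iso_GL2Z\<close>.\<close>

locale amalgam_normal_form = group G for G (structure) +
  fixes a b s z h
  assumes a [simp]: "a \<in> carrier G" and b [simp]: "b \<in> carrier G" and s [simp]: "s \<in> carrier G"
    and aa: "a \<otimes> a = z" and bbb: "b \<otimes> (b \<otimes> b) = z" and zz: "z \<otimes> z = \<one>" and ss: "s \<otimes> s = \<one>"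
    and sa: "(s \<otimes> a) \<otimes> (s \<otimes> a) = \<one>" and sb: "(s \<otimes> b) \<otimes> (s \<otimes> b) = \<one>"
    and h: "h \<in> hom G GL2Z"
    and h_gens: "h a = mat22 0 (-1) 1 0" "h b = mat22 1 (-1) 1 0" "h s = mat22 0 1 1 0"
begin

definition "positive = submonoid_gen G {z \<otimes> b \<otimes> a, z \<otimes> b \<otimes> b \<otimes> a}"
definition "head = {\<one>, a, z, z \<otimes> a}"
text \<open>Powers of \<open>b\<close> are taken modulo \<open>z\<close>; a further factor
  \<open>z\<close> is moved into \<open>head\<close>.\<close>

definition "tail = {\<one>, b, b \<otimes> b}"
definition "rotations = {c \<otimes> m \<otimes> d | c m d. c \<in> head \<and> m \<in> positive \<and> d \<in> tail}"
definition "normal_forms = rotations \<union> {n \<otimes> s | n. n \<in> rotations}"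

lemma z [simp]: "z \<in> carrier G" using aa by (metis a m_closed)

lemma z_comm: "a \<otimes> z = z \<otimes> a" "b \<otimes> z = z \<otimes> b"
  using aa bbb by (metis a m_assoc, metis b m_assoc m_closed)

text \<open>The trailing \<open>w\<close> lets each relation act inside a product nested to the
  right. As rewrite rules these move \<open>z\<close> to the front and shorten powers.\<close>

lemma left_comm:
  assumes "w \<in> carrier G"
  shows "a \<otimes> (a \<otimes> w) = z \<otimes> w" "b \<otimes> (b \<otimes> (b \<otimes> w)) = z \<otimes> w" "z \<otimes> (z \<otimes> w) = w"
    "a \<otimes> (z \<otimes> w) = z \<otimes> (a \<otimes> w)" "b \<otimes> (z \<otimes> w) = z \<otimes> (b \<otimes> w)"
proof -
  show "a \<otimes> (a \<otimes> w) = z \<otimes> w" using aa assms by (metis a m_assoc)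
  show "b \<otimes> (b \<otimes> (b \<otimes> w)) = z \<otimes> w" using bbb assms by (metis b m_assoc m_closed)
  show "z \<otimes> (z \<otimes> w) = w" using zz assms by (metis z m_assoc l_one)
  show "a \<otimes> (z \<otimes> w) = z \<otimes> (a \<otimes> w)" using z_comm assms by (metis a z m_assoc)
  show "b \<otimes> (z \<otimes> w) = z \<otimes> (b \<otimes> w)" using z_comm assms by (metis b z m_assoc)
qed

lemmas rewr = m_assoc left_comm z_comm aa bbb zz

lemma closed [simp]:
  "m \<in> positive \<Longrightarrow> m \<in> carrier G" "c \<in> head \<Longrightarrow> c \<in> carrier G" "d \<in> tail \<Longrightarrow> d \<in> carrier G"
  using submonoid_gen_closed[of "{z \<otimes> b \<otimes> a, z \<otimes> b \<otimes> b \<otimes> a}" m]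
  by (auto simp: positive_def head_def tail_def)

lemma rotations_closed [simp]: "n \<in> rotations \<Longrightarrow> n \<in> carrier G"
  by (auto simp: rotations_def)

lemma positive_z:
  assumes "m \<in> positive" shows "m \<otimes> z = z \<otimes> m"
  using assms unfolding positive_def
proof induction
  case (mult m x)
  then have "m \<in> carrier G" by (simp flip: positive_def)
  moreover from this have "m \<otimes> (z \<otimes> w) = z \<otimes> (m \<otimes> w)" if "w \<in> carrier G" for w
    using that mult.IH by (metis z m_assoc)
  ultimately show ?case using mult.hyps by (auto simp: rewr)
qed simp

lemma head_mult: "c \<in> head \<Longrightarrow> c \<otimes> a \<in> head" "c \<in> head \<Longrightarrow> c \<otimes> z \<in> head"
  by (auto simp: head_def rewr)

lemma rotationsI:
  "c \<in> head \<Longrightarrow> m \<in> positive \<Longrightarrow> d \<in> tail \<Longrightarrow> c \<otimes> (m \<otimes> d) \<in> rotations"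
  by (auto simp: rotations_def m_assoc[symmetric])

text \<open>A stray \<open>z\<close> travels left through \<open>m\<close> and is absorbed by
  \<open>head\<close>.\<close>

lemma rotations_zI:
  assumes "c \<in> head" "m \<in> positive" "d \<in> tail"
  shows "c \<otimes> (m \<otimes> (z \<otimes> d)) \<in> rotations"
proof -
  have "m \<otimes> (z \<otimes> d) = z \<otimes> (m \<otimes> d)"
    using positive_z[OF assms(2)] assms by (metis z closed m_assoc)
  then have "c \<otimes> (m \<otimes> (z \<otimes> d)) = (c \<otimes> z) \<otimes> (m \<otimes> d)" using assms by (simp add: m_assoc)
  then show ?thesis using rotationsI head_mult(2) assms by metis
qed

text \<open>The tail moves along 1, b, b^2; passing b^2 produces b^3 = z, which goes to the
  head.\<close>

lemma rotations_b:
  assumes "n \<in> rotations" shows "n \<otimes> b \<in> rotations"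
proof -
  obtain c m d where n: "n = c \<otimes> m \<otimes> d" and cmd: "c \<in> head" "m \<in> positive" "d \<in> tail"
    using assms by (auto simp: rotations_def)
  have "d = b \<otimes> b \<or> d \<otimes> b \<in> tail" using cmd(3) by (auto simp: tail_def)
  then show ?thesis
  proof
    assume "d = b \<otimes> b"
    then have "n \<otimes> b = c \<otimes> (m \<otimes> (z \<otimes> \<one>))" using cmd by (simp add: n rewr)
    then show ?thesis using rotations_zI[OF cmd(1,2), of \<one>] by (simp add: tail_def)
  next
    assume "d \<otimes> b \<in> tail"
    from rotationsI[OF cmd(1,2) this] show ?thesis using cmd by (simp add: n m_assoc)
  qed
qed

text \<open>A nontrivial tail followed by \<open>a\<close> completes a generator of
  \<open>positive\<close> up to a factor \<open>z\<close>. With trivial tail, the new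
  \<open>a\<close> meets the last factor of \<open>m\<close>, or the head if \<open>m\<close> is
  trivial.\<close>

lemma rotations_a:
  assumes "n \<in> rotations" shows "n \<otimes> a \<in> rotations"
proof -
  obtain c m d where n: "n = c \<otimes> m \<otimes> d" and cmd: "c \<in> head" "m \<in> positive" "d \<in> tail"
    using assms by (auto simp: rotations_def)
  have t: "\<one> \<in> tail" "b \<in> tail" "b \<otimes> b \<in> tail" by (simp_all add: tail_def)
  have pos: "m \<otimes> (z \<otimes> b \<otimes> a) \<in> positive" "m \<otimes> (z \<otimes> b \<otimes> b \<otimes> a) \<in> positive"
    using cmd(2) by (auto simp: positive_def intro: submonoid_gen.mult)
  consider "d = b" | "d = b \<otimes> b" | "d = \<one>" using cmd(3) by (auto simp: tail_def)
  then show ?thesis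
  proof cases
    case 1
    have "m \<otimes> (z \<otimes> b \<otimes> a) \<otimes> (z \<otimes> \<one>) = m \<otimes> (b \<otimes> a)" using cmd by (simp add: rewr)
    then show ?thesis
      using rotations_zI[OF cmd(1) pos(1) t(1)] cmd 1 by (simp add: n m_assoc)
  next
    case 2
    have "m \<otimes> (z \<otimes> b \<otimes> b \<otimes> a) \<otimes> (z \<otimes> \<one>) = m \<otimes> (b \<otimes> (b \<otimes> a))" using cmd by (simp add: rewr)
    then show ?thesis
      using rotations_zI[OF cmd(1) pos(2) t(1)] cmd 2 by (simp add: n m_assoc)
  next
    case 3
    from cmd(2) show ?thesis unfolding positive_def
    proof cases
      case one
      then have "n \<otimes> a = (c \<otimes> a) \<otimes> (\<one> \<otimes> \<one>)" using cmd 3 by (simp add: n)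
      moreover have "\<one> \<in> positive" by (simp add: positive_def submonoid_gen.one)
      ultimately show ?thesis using rotationsI[OF head_mult(1)] cmd(1) t(1) by metis
    next
      case (mult m' x)
      have m': "m' \<in> positive" using mult by (simp add: positive_def)
      \<comment> \<open>The two adjacent \<open>a\<close> give a second \<open>z\<close>, which
        cancels the first; the last generator dissolves into a tail.\<close>
      have "x \<otimes> a = b \<or> x \<otimes> a = b \<otimes> b" and "x \<in> carrier G" using mult by (auto simp: rewr)
      then show ?thesis using 3 cmd m' mult(1) t rotationsI[OF cmd(1) m']
        by (auto simp: n m_assoc)
    qed
  qed
qed

text \<open>The relation (s x)^2 = 1 says that \<open>s\<close> inverts \<open>x\<close>. The
  inverses are written as a^3 and b^5 so that \<open>rotations_a\<close> and
  \<open>rotations_b\<close> can be iterated.\<close>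

lemma flip_comm:
  "s \<otimes> a = a \<otimes> a \<otimes> a \<otimes> s" "s \<otimes> b = b \<otimes> b \<otimes> b \<otimes> b \<otimes> b \<otimes> s"
proof -
  have *: "s \<otimes> x = y \<otimes> s"
    if "x \<in> carrier G" "y \<in> carrier G" "(s \<otimes> x) \<otimes> (s \<otimes> x) = \<one>" "y \<otimes> x = \<one>" for x y
  proof -
    have "inv (s \<otimes> x) = s \<otimes> x" using that by (intro inv_equality) auto
    moreover have "inv s = s" using ss by (intro inv_equality) auto
    moreover have "inv x = y" using that by (intro inv_equality) auto
    ultimately show ?thesis using that by (metis s inv_mult_group)
  qed
  show "s \<otimes> a = a \<otimes> a \<otimes> a \<otimes> s" using sa by (intro *) (auto simp: rewr)
  show "s \<otimes> b = b \<otimes> b \<otimes> b \<otimes> b \<otimes> b \<otimes> s" using sb by (intro *) (auto simp: rewr)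
qed

lemma normal_forms_closed: "normal_forms \<subseteq> carrier G"
  by (auto simp: normal_forms_def)

lemma one_normal_form: "\<one> \<in> normal_forms"
proof -
  have "\<one> \<otimes> (\<one> \<otimes> \<one>) \<in> rotations"
    by (rule rotationsI) (auto simp: head_def tail_def positive_def submonoid_gen.one)
  then show ?thesis by (simp add: normal_forms_def)
qed

lemma normal_forms_mult:
  assumes "v \<in> normal_forms" "g \<in> {a, b, s}"
  shows "v \<otimes> g \<in> normal_forms"
proof -
  have "n \<otimes> s \<otimes> a \<in> normal_forms" "n \<otimes> s \<otimes> b \<in> normal_forms" "n \<otimes> s \<otimes> s \<in> normal_forms"
    if n: "n \<in> rotations" for n
  proof -
    have "n \<otimes> s \<otimes> a = n \<otimes> a \<otimes> a \<otimes> a \<otimes> s" using n flip_comm(1) by (simp add: m_assoc)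
    then show "n \<otimes> s \<otimes> a \<in> normal_forms"
      using rotations_a[OF rotations_a[OF rotations_a[OF n]]] by (auto simp: normal_forms_def)
    have "n \<otimes> s \<otimes> b = n \<otimes> b \<otimes> b \<otimes> b \<otimes> b \<otimes> b \<otimes> s" using n flip_comm(2) by (simp add: m_assoc)
    then show "n \<otimes> s \<otimes> b \<in> normal_forms"
      using rotations_b[OF rotations_b[OF rotations_b[OF rotations_b[OF rotations_b[OF n]]]]]
      by (auto simp: normal_forms_def)
    show "n \<otimes> s \<otimes> s \<in> normal_forms" using n ss by (simp add: m_assoc normal_forms_def)
  qed
  then show ?thesis
    using assms rotations_a rotations_b by (auto simp: normal_forms_def)
qed

section \<open>Matrices of normal forms\<close>

text \<open>Each generator adds one column to the other. Entries never decrease, and since the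
  diagonal is positive the first factor already makes \<open>q + r\<close> positive.\<close>

lemma positive_matrix:
  assumes "m \<in> positive"
  shows "\<exists>p q r t. h m = mat22 p q r t \<and> p \<ge> 1 \<and> q \<ge> 0 \<and> r \<ge> 0 \<and> t \<ge> 1 \<and> (m = \<one> \<or> q + r > 0)"
  using assms unfolding positive_def
proof induction
  case one
  have "h \<one> = mat22 1 0 0 1"
    using hom_one[OF h is_group group_GL2Z] by (simp add: GL2Z_mat22)
  then show ?case by (intro exI[of _ 1] exI[of _ 0]) auto
next
  case (mult m x)
  have hz: "h z = mat22 (-1) 0 0 (-1)"
    unfolding aa[symmetric] by (simp add: hom_mult[OF h] h_gens GL2Z_mat22)
  obtain p q r t where m: "h m = mat22 p q r t" "p \<ge> 1" "q \<ge> 0" "r \<ge> 0" "t \<ge> 1"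
    using mult.IH by blast
  have mc: "m \<in> carrier G" using mult.hyps(1) by (simp flip: positive_def)
  consider "x = z \<otimes> b \<otimes> a" | "x = z \<otimes> b \<otimes> b \<otimes> a" using mult.hyps(2) by blast
  then show ?case
  proof cases
    case 1
    then have "h (m \<otimes> x) = mat22 p (p + q) r (r + t)"
      using mc by (simp add: hom_mult[OF h] hz h_gens m GL2Z_mat22)
    then show ?thesis using m
      by (intro exI[of _ p] exI[of _ "p + q"] exI[of _ r] exI[of _ "r + t"])
        (auto simp: algebra_simps)
  next
    case 2
    then have "h (m \<otimes> x) = mat22 (p + q) q (r + t) t"
      using mc by (simp add: hom_mult[OF h] hz h_gens m GL2Z_mat22)
    then show ?thesis using m
      by (intro exI[of _ "p + q"] exI[of _ q] exI[of _ "r + t"] exI[of _ t])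
        (auto simp: algebra_simps)
  qed
qed

lemma normal_form_kernel:
  assumes "v \<in> normal_forms" "h v = mat22 1 0 0 1"
  shows "v = \<one>"
proof -
  obtain c m d e where v: "v = c \<otimes> m \<otimes> d \<otimes> e" "c \<in> head" "m \<in> positive" "d \<in> tail" "e \<in> {\<one>, s}"
  proof -
    have "\<exists>n\<in>rotations. \<exists>e\<in>{\<one>, s}. v = n \<otimes> e"
      using assms(1) r_one[OF rotations_closed[of v], symmetric]
      unfolding normal_forms_def by blast
    then obtain n e where "v = n \<otimes> e" "n \<in> rotations" "e \<in> {\<one>, s}" by blast
    moreover from this obtain c m d
      where "n = c \<otimes> m \<otimes> d" "c \<in> head" "m \<in> positive" "d \<in> tail"
      by (auto simp: rotations_def)
    ultimately show ?thesis using that[of c m d e] by simp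
  qed
  obtain p q r t where m: "h m = mat22 p q r t" "p \<ge> 1" "q \<ge> 0" "r \<ge> 0" "t \<ge> 1"
    "m = \<one> \<or> q + r > 0" using positive_matrix[OF v(3)] by blast
  have hz: "h z = mat22 (-1) 0 0 (-1)"
    unfolding aa[symmetric] by (simp add: hom_mult[OF h] h_gens GL2Z_mat22)
  have h1: "h \<one> = mat22 1 0 0 1"
    using hom_one[OF h is_group group_GL2Z] by (simp add: GL2Z_mat22)
  have "h v = h c \<otimes>\<^bsub>GL2Z\<^esub> h m \<otimes>\<^bsub>GL2Z\<^esub> h d \<otimes>\<^bsub>GL2Z\<^esub> h e"
  proof -
    have "e \<in> carrier G" using v(5) by auto
    then show ?thesis using v(2-4) by (simp add: v(1) hom_mult[OF h])
  qed
  then have "h c \<otimes>\<^bsub>GL2Z\<^esub> mat22 p q r t \<otimes>\<^bsub>GL2Z\<^esub> h d \<otimes>\<^bsub>GL2Z\<^esub> h e = mat22 1 0 0 1"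
    using assms(2) m(1) by simp
  moreover have "c = \<one> \<and> h c = mat22 1 0 0 1 \<or> h c = mat22 0 (-1) 1 0 \<or>
      h c = mat22 (-1) 0 0 (-1) \<or> h c = mat22 0 1 (-1) 0"
    using v(2) by (auto simp: head_def hom_mult[OF h] hz h_gens h1 GL2Z_mat22)
  moreover have "d = \<one> \<and> h d = mat22 1 0 0 1 \<or> h d = mat22 1 (-1) 1 0 \<or>
      h d = mat22 0 (-1) 1 (-1)"
    using v(4) by (auto simp: tail_def hom_mult[OF h] h_gens h1 GL2Z_mat22)
  moreover have "e = \<one> \<and> h e = mat22 1 0 0 1 \<or> h e = mat22 0 1 1 0"
    using v(5) h1 h_gens by auto
  \<comment> \<open>Each of the 24 combinations gives linear equations in \<open>p\<close>,
    \<open>q\<close>, \<open>r\<close>, \<open>t\<close>; the sign bounds exclude all but the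
    trivial one.\<close>
  ultimately have "c = \<one> \<and> d = \<one> \<and> e = \<one> \<and> q + r = 0"
    using m(2-5) by (elim disjE conjE; simp add: GL2Z_mat22 mat22_simps; linarith?)
  then show ?thesis using v(1) m(6) by simp
qed

lemma iso_GL2Z:
  assumes "carrier G \<subseteq> normal_forms"
  shows "h \<in> iso G GL2Z"
proof -
  interpret group_hom G GL2Z h
    by (intro group_hom.intro group_hom_axioms.intro is_group group_GL2Z h)
  have "inj_on h (carrier G)"
    using assms normal_form_kernel by (auto simp: inj_on_one_iff GL2Z_mat22)
  moreover have "carrier GL2Z \<subseteq> h ` carrier G"
  proof (rule GL2Z_generated)
    fix x y assume "x \<in> h ` carrier G" "y \<in> h ` carrier G"
    then obtain u v where "u \<in> carrier G" "v \<in> carrier G" "x = h u" "y = h v" by blast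
    then show "x \<otimes>\<^bsub>GL2Z\<^esub> y \<in> h ` carrier G" by (auto simp flip: hom_mult)
  qed (metis a b s h_gens image_eqI)+
  ultimately show ?thesis
    using h by (auto simp: iso_def bij_betw_def hom_closed)
qed

end

section \<open>The isomorphism\<close>

text \<open>Multiplying by the flip swaps the rows, so the last hypothesis is the relation (s r)^2 =
  1.\<close>

lemma dihedral_GL2Z_hom:
  assumes "mat22 p q r t \<in> carrier GL2Z" "mat22 p q r t [^]\<^bsub>GL2Z\<^esub> n = \<one>\<^bsub>GL2Z\<^esub>"
    and "mat22 r t p q \<otimes>\<^bsub>GL2Z\<^esub> mat22 r t p q = \<one>\<^bsub>GL2Z\<^esub>"
  obtains k where "k \<in> hom (dihedral n) GL2Z" "k (dihedral_gen n Rot) = mat22 p q r t"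
    "k (dihedral_gen n Flip) = mat22 0 1 1 0"
proof -
  have prems: "mat22 0 1 1 0 \<in> carrier GL2Z"
    "mat22 0 1 1 0 \<otimes>\<^bsub>GL2Z\<^esub> mat22 0 1 1 0 = \<one>\<^bsub>GL2Z\<^esub>"
    "(mat22 0 1 1 0 \<otimes>\<^bsub>GL2Z\<^esub> mat22 p q r t) \<otimes>\<^bsub>GL2Z\<^esub> (mat22 0 1 1 0 \<otimes>\<^bsub>GL2Z\<^esub> mat22 p q r t)
      = \<one>\<^bsub>GL2Z\<^esub>"
    using assms(3) by (simp_all add: GL2Z_mat22)
  note lift = group_GL2Z assms(1) prems(1) assms(2) prems(2,3)
  show ?thesis using that[OF dihedral_lift_hom[OF lift] dihedral_lift_gen[OF lift]] .
qed

theorem theorem3: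
  shows "GL2Z \<cong> amalgam (dihedral 2) (dihedral 4) (dihedral 6) (dihedral_map 4 2) (dihedral_map 6 3)"
proof -
  let ?f = "dihedral_map 4 2" and ?g = "dihedral_map 6 3"
  define P where "P = amalgam (dihedral 2) (dihedral 4) (dihedral 6) ?f ?g"
  define inl where "inl = amalgam_inl (dihedral 2) (dihedral 4) (dihedral 6) ?f ?g"
  define inr where "inr = amalgam_inr (dihedral 2) (dihedral 4) (dihedral 6) ?f ?g"
  define a b s where "a = inl (dihedral_gen 4 Rot)" and "b = inr (dihedral_gen 6 Rot)"
    and "s = inl (dihedral_gen 4 Flip)"
  note gc = dihedral_gen_closed
  interpret D2: group "dihedral 2" by (rule group_dihedral)
  interpret D4: group "dihedral 4" by (rule group_dihedral)
  interpret D6: group "dihedral 6" by (rule group_dihedral)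
  interpret P: group P unfolding P_def by (intro group_amalgam group_dihedral)
  interpret GL: group GL2Z by (rule group_GL2Z)
  have dvd: "(4::nat) dvd 2 * 2" "(6::nat) dvd 2 * 3" by simp_all
  have f: "?f \<in> hom (dihedral 2) (dihedral 4)" and g: "?g \<in> hom (dihedral 2) (dihedral 6)"
    using dihedral_map_hom dvd by blast+
  note fg = dihedral_map_Rot[OF dvd(1)] dihedral_map_Flip[OF dvd(1)]
    dihedral_map_Rot[OF dvd(2)] dihedral_map_Flip[OF dvd(2)]
  have inl: "inl \<in> hom (dihedral 4) P" and inr: "inr \<in> hom (dihedral 6) P"
    by (simp_all add: inl_def inr_def P_def amalgam_inl_hom amalgam_inr_hom)
  have glue: "inl (?f x) = inr (?g x)" if "x \<in> carrier (dihedral 2)" for x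
    using amalgam_commute[OF that] by (simp add: inl_def inr_def)
  have s': "inr (dihedral_gen 6 Flip) = s"
    using glue[OF gc[of 2 Flip]] by (simp add: fg s_def)
  have cl: "a \<in> carrier P" "b \<in> carrier P" "s \<in> carrier P"
    using gc hom_in_carrier[OF inl] hom_in_carrier[OF inr] by (auto simp: a_def b_def s_def)
  \<comment> \<open>Gluing at the rotation of D_2, which maps to r^2 on one side and to r^3 on the
    other.\<close>
  have bbb: "b \<otimes>\<^bsub>P\<^esub> (b \<otimes>\<^bsub>P\<^esub> b) = a \<otimes>\<^bsub>P\<^esub> a"
    using glue[OF gc[of 2 Rot]] gc[of 4 Rot] gc[of 6 Rot] cl
    by (simp add: fg D4.nat_pow_2_3 D6.nat_pow_2_3 hom_mult[OF inl] hom_mult[OF inr] P.m_assoc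
        flip: a_def b_def)
  have zz: "(a \<otimes>\<^bsub>P\<^esub> a) \<otimes>\<^bsub>P\<^esub> (a \<otimes>\<^bsub>P\<^esub> a) = \<one>\<^bsub>P\<^esub>"
    using arg_cong[OF dihedral_relations(1)[of 4], of inl] gc[of 4 Rot]
      arg_cong[OF D4.nat_pow_mult[OF gc[of 4 Rot], of 2 2], of inl]
      hom_one[OF inl D4.is_group P.is_group]
    by (simp add: D4.nat_pow_2_3 hom_mult[OF inl] flip: a_def)
  have flips: "s \<otimes>\<^bsub>P\<^esub> s = \<one>\<^bsub>P\<^esub>" "(s \<otimes>\<^bsub>P\<^esub> a) \<otimes>\<^bsub>P\<^esub> (s \<otimes>\<^bsub>P\<^esub> a) = \<one>\<^bsub>P\<^esub>"
      "(s \<otimes>\<^bsub>P\<^esub> b) \<otimes>\<^bsub>P\<^esub> (s \<otimes>\<^bsub>P\<^esub> b) = \<one>\<^bsub>P\<^esub>"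
    using arg_cong[OF dihedral_relations(2)[of 4], of inl]
      arg_cong[OF dihedral_relations(3)[of 4], of inl]
      arg_cong[OF dihedral_relations(3)[of 6], of inr] gc
      hom_one[OF inl D4.is_group P.is_group] hom_one[OF inr D6.is_group P.is_group]
    by (simp_all add: hom_mult[OF inl] hom_mult[OF inr] s' flip: a_def b_def s_def)
  obtain \<alpha> where \<alpha>: "\<alpha> \<in> hom (dihedral 4) GL2Z" "\<alpha> (dihedral_gen 4 Rot) = mat22 0 (-1) 1 0"
      "\<alpha> (dihedral_gen 4 Flip) = mat22 0 1 1 0"
    by (rule dihedral_GL2Z_hom[of 0 "-1" 1 0 4])
      (simp_all add: GL2Z_mat22 numeral_eq_Suc nat_pow_def)
  obtain \<beta> where \<beta>: "\<beta> \<in> hom (dihedral 6) GL2Z" "\<beta> (dihedral_gen 6 Rot) = mat22 1 (-1) 1 0"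
      "\<beta> (dihedral_gen 6 Flip) = mat22 0 1 1 0"
    by (rule dihedral_GL2Z_hom[of 1 "-1" 1 0 6])
      (simp_all add: GL2Z_mat22 numeral_eq_Suc nat_pow_def)
  \<comment> \<open>Checked at the four elements of D_2: the square of the first rotation matrix and
    the cube of the second are both minus the identity, and the flips share a matrix.\<close>
  have "\<alpha> (?f x) = \<beta> (?g x)" if "x \<in> carrier (dihedral 2)" for x
    using dihedral_2_elements[OF that] gc[of 2] gc[of 4] gc[of 6] \<alpha> \<beta>
    by (auto simp: fg hom_mult[OF f] hom_mult[OF g] hom_mult[OF \<alpha>(1)] hom_mult[OF \<beta>(1)]
        hom_one[OF f D2.is_group D4.is_group] hom_one[OF g D2.is_group D6.is_group]
        hom_one[OF \<alpha>(1) D4.is_group GL.is_group] hom_one[OF \<beta>(1) D6.is_group GL.is_group]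
        D4.nat_pow_2_3 D6.nat_pow_2_3 GL2Z_mat22)
  then obtain h where h: "h \<in> hom P GL2Z" "\<forall>x\<in>carrier (dihedral 4). h (inl x) = \<alpha> x"
      "\<forall>y\<in>carrier (dihedral 6). h (inr y) = \<beta> y"
    using ex1_implies_ex[OF amalgam_universal[OF group_dihedral group_dihedral group_GL2Z
        f g \<alpha>(1) \<beta>(1)]]
    unfolding P_def inl_def inr_def by blast
  \<comment> \<open>With z = a^2, the relation b^3 = z is the gluing and z^2 = 1 is a^4 = 1.\<close>
  interpret amalgam_normal_form P a b s "a \<otimes>\<^bsub>P\<^esub> a" h
    by unfold_locales
      (use cl bbb zz flips h gc \<alpha> \<beta> in \<open>auto simp: a_def b_def s_def\<close>)
  have gens: "inl (dihedral_gen 4 y) \<in> {a, b, s}" "inr (dihedral_gen 6 y) \<in> {a, b, s}" for y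
    using s' by (cases y; simp add: a_def b_def s_def)+
  \<comment> \<open>Normal forms contain the identity and absorb \<open>a\<close>, \<open>b\<close>,
    \<open>s\<close>, hence the images of both dihedral groups.\<close>
  have "carrier P \<subseteq> normal_forms"
    unfolding P_def
  proof (rule amalgam_subset_right_closed; fold P_def inl_def inr_def)
    show "\<one>\<^bsub>P\<^esub> \<in> normal_forms" by (rule one_normal_form)
    show "v \<otimes>\<^bsub>P\<^esub> inl x \<in> normal_forms"
      if "v \<in> normal_forms" "x \<in> carrier (dihedral 4)" for v x
      by (rule dihedral_image_right_closed[OF P.is_group _ inl normal_forms_closed])
        (use that gens normal_forms_mult in auto)
    show "v \<otimes>\<^bsub>P\<^esub> inr x \<in> normal_forms"
      if "v \<in> normal_forms" "x \<in> carrier (dihedral 6)" for v x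
      by (rule dihedral_image_right_closed[OF P.is_group _ inr normal_forms_closed])
        (use that gens normal_forms_mult in auto)
  qed
  then have "h \<in> iso P GL2Z" by (rule iso_GL2Z)
  then show ?thesis
    unfolding P_def[symmetric] by (meson P.iso_sym is_isoI)
qed

end
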